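(* Let $\Sigma^-_{xx}\in\mathbb{R}^{N\times N}$, $\Sigma^-_{xy}\in\mathbb{R}^{N\times m}$, $\Sigma^-_{yy}\in\mathbb{R}^{m\times m}$ be the blocks of a (symmetric positive semidefinite) joint prior covariance matrix, let $\mathcal{R}^{\text{sensor}}\in\mathbb{R}^{m\times m}$ be a diagonal matrix with positive diagonal entries, and let $M_p\in\mathbb{R}^{r\times N}$ and $\gamma_p\in\mathbb{R}$. Consider the optimization problem over symmetric $\mathcal{R}^{\text{data}}\in\mathbb{R}^{m\times m}$ and symmetric $Q_p\in\mathbb{R}^{r\times r}$: $$\min_{\mathcal{R}^{\text{data}}\ge 0,\;Q_p\ge 0}\ \operatorname{tr}(\mathcal{R}^{\text{data}})$$ subject to $$\begin{bmatrix} M_p\Sigma^-_{xx}M_p^T-Q_p & M_p\Sigma^-_{xy}\\ (\Sigma^-_{xy})^TM_p^T & \Sigma^-_{yy}+\mathcal{R}^{\text{sensor}}+\mathcal{R}^{\text{data}}\end{bmatrix}\ge 0,\qquad \operatorname{tr}(Q_p)\ge\gamma_p .$$ Then the minimum synthetic noise satisfying the privacy constraint $\operatorname{tr}(\Sigma^+_{x_px_p})\ge\gamma_p$ is given by the solution of this problem. That is, if $(\mathcal{R}^{\text{data}},Q_p)$ is an optimal solution, then synthetic noise with covariance $\mathcal{R}^{\text{data}}$ satisfies $\operatorname{tr}(\Sigma^+_{x_px_p})\ge\gamma_p$, and $\mathcal{R}^{\text{data}}$ has the smallest trace among all synthetic noise covariances $\mathcal{R}'\ge0$ for which $\operatorn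ame{tr}(\Sigma^+_{x_px_p})\ge\gamma_p$.
   Context: For symmetric matrices, $A\ge B$ means $A-B$ is positive semidefinite. A fixed time step of an Ensemble/Unscented Kalman filter is considered and the time index is suppressed. $\Sigma^-_{xx},\Sigma^-_{xy},\Sigma^-_{yy}$ are the prior state covariance, the state/noise-free-measurement cross covariance, and the noise-free-measurement covariance, so that $\begin{bmatrix}\Sigma^-_{xx}&\Sigma^-_{xy}\\(\Sigma^-_{xy})^T&\Sigma^-_{yy}\end{bmatrix}\ge0$. The measurement noise covariance is $\mathcal{R}^{\text{sensor}}+\mathcal{R}^{\text{data}}$, where $\mathcal{R}^{\text{sensor}}$ is the known sensor noise covariance and $\mathcal{R}^{\text{data}}$ (symmetric, positive semidefinite) is the covariance of added synthetic noise. The posterior error covariance of the privacy variable $X_p=M_pX$ is $$\Sigma^+_{x_px_p}:=M_p\Sigma^-_{xx}M_p^T-M_p\Sigma^-_{xy}\left(\Sigma^-_{yy}+\mathcal{R}^{\text{sensor}}+\mathcal{R}^{\text{data}}\right)^{-1}(\Sigma^-_{xy})^TM_p^T .$$ "Minimum noise" means minimum trace of the synthetic noise covariance. *)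

theory Defs
  imports "HOL-Analysis.Analysis"
begin

text \<open>A \<open>p \<times> q\<close> real matrix has type \<open>real ^ 'q ^ 'p\<close> (columns first).\<close>

definition psd :: "real ^ 'n ^ 'n \<Rightarrow> bool" where
  "psd A \<longleftrightarrow> transpose A = A \<and> (\<forall>x. 0 \<le> x \<bullet> (A *v x))"

text \<open>The block matrix with rows \<open>[A, B]\<close> and \<open>[C, D]\<close>, indexed by the disjoint sum of
  the index types of its blocks.\<close>

definition block_matrix ::
  "'a ^ 'n ^ 'p \<Rightarrow> 'a ^ 'm ^ 'p \<Rightarrow> 'a ^ 'n ^ 'q \<Rightarrow> 'a ^ 'm ^ 'q \<Rightarrow> 'a ^ ('n + 'm) ^ ('p + 'q)" where
  "block_matrix A B C D = (\<chi> i j.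
     case i of
       Inl k \<Rightarrow> (case j of Inl l \<Rightarrow> A $ k $ l | Inr l \<Rightarrow> B $ k $ l)
     | Inr k \<Rightarrow> (case j of Inl l \<Rightarrow> C $ k $ l | Inr l \<Rightarrow> D $ k $ l))"

definition positive_diagonal :: "real ^ 'm ^ 'm \<Rightarrow> bool" where
  "positive_diagonal R \<longleftrightarrow> (\<forall>i j. i \<noteq> j \<longrightarrow> R $ i $ j = 0) \<and> (\<forall>i. 0 < R $ i $ i)"

text \<open>The library's \<open>matrix_inv\<close> is unspecified on singular matrices. Below, the inverted
  matrix is positive definite as soon as \<open>Syy\<close> and \<open>Rdata\<close> are positive semidefinite and
  \<open>Rsensor\<close> is diagonal with positive diagonal entries.\<close>

definition posterior_cov ::
  "real ^ 'n ^ 'n \<Rightarrow> real ^ 'm ^ 'n \<Rightarrow> real ^ 'm ^ 'm \<Rightarrow> real ^ 'm ^ 'm \<Rightarrow> real ^ 'n ^ 'r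
     \<Rightarrow> real ^ 'm ^ 'm \<Rightarrow> real ^ 'r ^ 'r" where
  "posterior_cov Sxx Sxy Syy Rsensor Mp Rdata =
     Mp ** Sxx ** transpose Mp
     - Mp ** Sxy ** matrix_inv (Syy + Rsensor + Rdata) ** transpose Sxy ** transpose Mp"

definition feasible ::
  "real ^ 'n ^ 'n \<Rightarrow> real ^ 'm ^ 'n \<Rightarrow> real ^ 'm ^ 'm \<Rightarrow> real ^ 'm ^ 'm \<Rightarrow> real ^ 'n ^ 'r \<Rightarrow> real
     \<Rightarrow> (real ^ 'm ^ 'm) \<times> (real ^ 'r ^ 'r) \<Rightarrow> bool" where
  "feasible Sxx Sxy Syy Rsensor Mp gp = (\<lambda>(Rdata, Qp).
     psd Rdata \<and> psd Qp \<and>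
     psd (block_matrix (Mp ** Sxx ** transpose Mp - Qp) (Mp ** Sxy)
                       (transpose Sxy ** transpose Mp) (Syy + Rsensor + Rdata)) \<and>
     trace Qp \<ge> gp)"

definition optimal_solution ::
  "real ^ 'n ^ 'n \<Rightarrow> real ^ 'm ^ 'n \<Rightarrow> real ^ 'm ^ 'm \<Rightarrow> real ^ 'm ^ 'm \<Rightarrow> real ^ 'n ^ 'r \<Rightarrow> real
     \<Rightarrow> (real ^ 'm ^ 'm) \<times> (real ^ 'r ^ 'r) \<Rightarrow> bool" where
  "optimal_solution Sxx Sxy Syy Rsensor Mp gp =
     is_arg_min (\<lambda>(Rdata, Qp). trace Rdata) (feasible Sxx Sxy Syy Rsensor Mp gp)"

end

theory Submission
  imports Defs
begin

text \<open>Completing the square in the block quadratic form shows that, for positive definite \<open>D\<close>,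
  the block matrix is positive semidefinite iff its Schur complement \<open>A - B D\<^sup>-\<^sup>1 B\<^sup>T\<close> is.
  Applied to the linear matrix inequality this says \<open>Q\<^sub>p \<le> \<Sigma>\<^sup>+\<close>, so the noise
  covariances occurring in feasible pairs are exactly those meeting the privacy constraint: the trace is
  monotone, and conversely \<open>Q\<^sub>p = \<Sigma>\<^sup>+\<close> is feasible, since \<open>\<Sigma>\<^sup>+\<close> is itself
  a congruence of a Schur complement of a positive semidefinite matrix.\<close>

section \<open>Transposes, congruences and traces\<close>

lemma inner_matrix_vector_transpose:
  fixes A :: "real ^ 'n ^ 'm"
  shows "x \<bullet> (A *v y) = (transpose A *v x) \<bullet> y"
  by (simp add: dot_lmul_matrix)

lemma transpose_add: "transpose (A + B) = transpose A + transpose B"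
  by (simp add: transpose_def vec_eq_iff)

lemma transpose_diff: "transpose (A - B) = transpose A - transpose B"
  by (simp add: transpose_def vec_eq_iff)

lemma matrix_diff_ldistrib: "A ** (B - C) = A ** B - A ** (C :: 'a::ring_1 ^ 'n ^ 'm)"
  by (simp add: matrix_matrix_mult_def vec_eq_iff right_diff_distrib sum_subtractf)

lemma matrix_diff_rdistrib: "(A - B) ** C = A ** C - B ** (C :: 'a::ring_1 ^ 'n ^ 'm)"
  by (simp add: matrix_matrix_mult_def vec_eq_iff left_diff_distrib sum_subtractf)

lemma psd_add: "psd A \<Longrightarrow> psd B \<Longrightarrow> psd (A + B)"
  by (simp add: psd_def transpose_add matrix_vector_mult_add_rdistrib inner_add_right)

lemma psd_congruence:
  fixes M :: "real ^ 'n ^ 'r"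
  assumes "psd A"
  shows "psd (M ** A ** transpose M)"
proof -
  have "x \<bullet> ((M ** A ** transpose M) *v x) = (transpose M *v x) \<bullet> (A *v (transpose M *v x))" for x
    by (simp only: matrix_vector_mul_assoc [symmetric] inner_matrix_vector_transpose [of x M])
  with assms show ?thesis
    by (simp add: psd_def matrix_transpose_mul matrix_mul_assoc)
qed

text \<open>The diagonal entries are values of the quadratic form at unit vectors. Applied to a
  difference of matrices, this makes the trace monotone.\<close>

lemma trace_psd_nonneg:
  assumes "psd A"
  shows "0 \<le> trace A"
proof -
  have "A $ i $ i = axis i 1 \<bullet> (A *v axis i 1)" for i
    by (simp add: matrix_vector_mult_basis column_def inner_axis')
  then have "0 \<le> A $ i $ i" for i
    using assms by (simp add: psd_def)
  then show ?thesis
    by (simp add: trace_def sum_nonneg)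
qed

section \<open>Block vectors and the quadratic form of a block matrix\<close>

definition block_vector :: "'a ^ 'n \<Rightarrow> 'a ^ 'm \<Rightarrow> 'a ^ ('n + 'm)" where
  "block_vector u v = (\<chi> i. case i of Inl k \<Rightarrow> u $ k | Inr l \<Rightarrow> v $ l)"

lemma block_vector_exhaust:
  obtains u v where "z = block_vector u v"
proof
  show "z = block_vector (\<chi> k. z $ Inl k) (\<chi> l. z $ Inr l)"
    by (simp add: block_vector_def vec_eq_iff split: sum.split)
qed

lemma sum_UNIV_sum:
  fixes f :: "'a::finite + 'b::finite \<Rightarrow> 'c::comm_monoid_add"
  shows "sum f UNIV = (\<Sum>k\<in>UNIV. f (Inl k)) + (\<Sum>l\<in>UNIV. f (Inr l))"
  by (simp add: UNIV_Plus_UNIV [symmetric] sum.Plus del: UNIV_Plus_UNIV)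

lemma inner_block_vector: "block_vector u v \<bullet> block_vector u' v' = u \<bullet> u' + v \<bullet> v'"
  by (simp add: inner_vec_def sum_UNIV_sum block_vector_def)

lemma block_matrix_vector:
  "block_matrix A B C D *v block_vector u v = block_vector (A *v u + B *v v) (C *v u + D *v v)"
  by (simp add: vec_eq_iff matrix_vector_mult_def sum_UNIV_sum block_matrix_def block_vector_def
      split: sum.split)

lemma transpose_block_matrix:
  "transpose (block_matrix A B C D) =
     block_matrix (transpose A) (transpose C) (transpose B) (transpose D)"
  by (simp add: vec_eq_iff transpose_def block_matrix_def split: sum.split)

lemma block_matrix_eq_iff:
  "block_matrix A B C D = block_matrix A' B' C' D' \<longleftrightarrow> A = A' \<and> B = B' \<and> C = C' \<and> D = D'"
  by (auto simp add: block_matrix_def vec_eq_iff split_sum_all)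

text \<open>Every vector indexed by a sum type splits into two blocks, and the two cross terms agree
  because the lower left block is \<open>transpose B\<close>. The same choice makes the symmetry of
  the off-diagonal blocks automatic.\<close>

lemma psd_block_matrix_iff:
  fixes B :: "real ^ 'm ^ 'n"
  shows "psd (block_matrix A B (transpose B) D) \<longleftrightarrow>
    transpose A = A \<and> transpose D = D \<and>
    (\<forall>u v. 0 \<le> u \<bullet> (A *v u) + 2 * (u \<bullet> (B *v v)) + v \<bullet> (D *v v))"
proof -
  have "block_vector u v \<bullet> (block_matrix A B (transpose B) D *v block_vector u v)
      = u \<bullet> (A *v u) + 2 * (u \<bullet> (B *v v)) + v \<bullet> (D *v v)" for u v
    by (simp add: block_matrix_vector inner_block_vector inner_add_right
        inner_matrix_vector_transpose [of u B v] inner_commute [of v] del: transpose_matrix_vector)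
  moreover have "(\<forall>z. P z) \<longleftrightarrow> (\<forall>u v. P (block_vector u v))" for P :: "real ^ ('n + 'm) \<Rightarrow> bool"
    by (metis block_vector_exhaust)
  ultimately show ?thesis
    by (auto simp add: psd_def transpose_block_matrix block_matrix_eq_iff)
qed

section \<open>Positive definite matrices and their inverses\<close>

definition pd :: "real ^ 'n ^ 'n \<Rightarrow> bool" where
  "pd A \<longleftrightarrow> transpose A = A \<and> (\<forall>x. x \<noteq> 0 \<longrightarrow> 0 < x \<bullet> (A *v x))"

lemma psd_if_pd: "pd A \<Longrightarrow> psd A"
  unfolding pd_def psd_def by (metis inner_zero_left less_imp_le order_refl)

lemma pd_add_psd: "pd A \<Longrightarrow> psd B \<Longrightarrow> pd (A + B)"
  by (simp add: pd_def psd_def transpose_add matrix_vector_mult_add_rdistrib inner_add_right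
      add_pos_nonneg)

text \<open>The quadratic form is a sum of squares with positive weights, so one nonzero coordinate
  of \<open>x\<close> makes it strictly positive.\<close>

lemma pd_if_positive_diagonal:
  assumes "positive_diagonal R"
  shows "pd R"
proof -
  have off: "R $ i $ j = 0" if "i \<noteq> j" for i j
    using assms that by (simp add: positive_diagonal_def)
  have pos: "0 < R $ i $ i" for i
    using assms by (simp add: positive_diagonal_def)
  have sym: "transpose R = R"
    by (simp add: transpose_def vec_eq_iff) (metis off)
  have "(\<Sum>j\<in>UNIV. R $ i $ j * x $ j) = R $ i $ i * x $ i" for i x
    using sum.remove [of UNIV i "\<lambda>j. R $ i $ j * x $ j"] by (simp add: off)
  then have quad: "x \<bullet> (R *v x) = (\<Sum>i\<in>UNIV. R $ i $ i * (x $ i)\<^sup>2)" for x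
    by (simp add: inner_vec_def matrix_vector_mult_def power2_eq_square mult_ac)
  have "0 < x \<bullet> (R *v x)" if "x \<noteq> 0" for x
  proof -
    obtain k where "x $ k \<noteq> 0"
      using \<open>x \<noteq> 0\<close> by (auto simp add: vec_eq_iff)
    then show ?thesis
      unfolding quad by (intro sum_pos2 [of _ k]) (simp_all add: pos less_imp_le)
  qed
  with sym show ?thesis
    by (simp add: pd_def)
qed

text \<open>At a kernel vector the quadratic form is zero, so the vector vanishes; a square matrix
  with trivial kernel is invertible.\<close>

lemma pd_invertible: "pd A \<Longrightarrow> invertible A"
  unfolding invertible_left_inverse matrix_left_invertible_ker pd_def
  by (metis inner_zero_right less_irrefl)

lemma matrix_inv_right: "invertible A \<Longrightarrow> A ** matrix_inv A = mat 1"
  unfolding invertible_def matrix_inv_def by (rule someI2_ex) auto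

text \<open>Transposing \<open>A ** matrix_inv A = mat 1\<close> yields a left inverse of
  \<open>A\<close>, and a left inverse coincides with a right inverse.\<close>

lemma matrix_inv_symmetric:
  fixes A :: "real ^ 'n ^ 'n"
  assumes "invertible A" and "transpose A = A"
  shows "transpose (matrix_inv A) = matrix_inv A"
proof -
  have "transpose (matrix_inv A) ** A = mat 1"
    by (metis assms matrix_inv_right matrix_transpose_mul transpose_mat)
  then show ?thesis
    by (metis assms(1) matrix_inv_right matrix_mul_assoc matrix_mul_lid matrix_mul_rid)
qed

section \<open>Schur complements\<close>

lemma psd_block_matrix_schur:
  fixes B :: "real ^ 'm ^ 'n"
  assumes "pd D" and A: "transpose A = A"
  shows "psd (block_matrix A B (transpose B) D) \<longleftrightarrow> psd (A - B ** matrix_inv D ** transpose B)"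
proof -
  define V where "V = matrix_inv D"
  have D: "transpose D = D" and inv: "invertible D" and psd: "0 \<le> w \<bullet> (D *v w)" for w
    using assms psd_if_pd [of D] by (auto simp add: pd_def psd_def pd_invertible)
  have V: "transpose V = V"
    unfolding V_def by (rule matrix_inv_symmetric [OF inv D])
  have DV: "D *v (V *v x) = x" for x
    by (simp add: V_def matrix_vector_mul_assoc matrix_inv_right [OF inv])
  \<comment> \<open>For fixed \<open>u\<close> the form is minimal at
    \<open>v = - (V *v (transpose B *v u))\<close>; measuring \<open>v\<close> from this minimiser
    removes the cross term.\<close>
  have square: "u \<bullet> (A *v u) + 2 * (u \<bullet> (B *v v)) + v \<bullet> (D *v v)
      = u \<bullet> ((A - B ** V ** transpose B) *v u)
        + (v + V *v (transpose B *v u)) \<bullet> (D *v (v + V *v (transpose B *v u)))" for u v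
  proof -
    define b where "b = transpose B *v u"
    have 1: "u \<bullet> (B *v w) = b \<bullet> w" for w
      unfolding b_def by (rule inner_matrix_vector_transpose)
    \<comment> \<open>The symmetric \<open>D\<close> moves across the inner product and cancels
      against \<open>V\<close>.\<close>
    have 2: "(D *v v) \<bullet> (V *v b) = b \<bullet> v"
      by (simp only: inner_commute [of "D *v v"] inner_matrix_vector_transpose [of _ D] D DV)
    have 3: "u \<bullet> ((A - B ** V ** transpose B) *v u) = u \<bullet> (A *v u) - b \<bullet> (V *v b)"
      by (simp only: matrix_vector_mult_diff_rdistrib inner_diff_right
          matrix_vector_mul_assoc [symmetric] b_def [symmetric] 1)
    show ?thesis
      unfolding b_def [symmetric] 3 1 matrix_vector_right_distrib DV inner_add_left inner_add_right
        inner_commute [of "V *v b" "D *v v"] 2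
      by (simp add: inner_commute)
  qed
  have sym: "transpose (A - B ** V ** transpose B) = A - B ** V ** transpose B"
    by (simp add: transpose_diff matrix_transpose_mul V A matrix_mul_assoc)
  have "(\<forall>u v. 0 \<le> u \<bullet> (A *v u) + 2 * (u \<bullet> (B *v v)) + v \<bullet> (D *v v)) \<longleftrightarrow>
      (\<forall>u. 0 \<le> u \<bullet> ((A - B ** V ** transpose B) *v u))"
  proof (intro iffI allI)
    fix u
    assume *: "\<forall>u v. 0 \<le> u \<bullet> (A *v u) + 2 * (u \<bullet> (B *v v)) + v \<bullet> (D *v v)"
    show "0 \<le> u \<bullet> ((A - B ** V ** transpose B) *v u)"
      \<comment> \<open>At the minimiser the completed square is zero and only the Schur complement
        remains.\<close>
      using * [unfolded square, rule_format, of u "- (V *v (transpose B *v u))"] by simp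
  next
    fix u v
    assume "\<forall>u. 0 \<le> u \<bullet> ((A - B ** V ** transpose B) *v u)"
    then show "0 \<le> u \<bullet> (A *v u) + 2 * (u \<bullet> (B *v v)) + v \<bullet> (D *v v)"
      unfolding square by (intro add_nonneg_nonneg psd) simp
  qed
  then show ?thesis
    unfolding psd_block_matrix_iff unfolding V_def [symmetric] by (simp add: psd_def sym A D)
qed

section \<open>Covariances of the filter and the feasible set\<close>

context
  fixes Sxx :: "real ^ 'n ^ 'n"
    and Sxy :: "real ^ 'm ^ 'n"
    and Syy Rsensor :: "real ^ 'm ^ 'm"
    and Mp :: "real ^ 'n ^ 'r"
  assumes joint: "psd (block_matrix Sxx Sxy (transpose Sxy) Syy)"
    and sensor: "positive_diagonal Rsensor"
begin

text \<open>\<open>Syy\<close> inherits semidefiniteness from the joint prior, and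
  \<open>Rsensor\<close> supplies strictness. Hence the \<open>matrix_inv\<close> in
  \<open>posterior_cov\<close> is a genuine inverse.\<close>

lemma pd_innovation_cov:
  assumes "psd R"
  shows "pd (Syy + Rsensor + R)"
proof -
  have quad: "0 \<le> u \<bullet> (Sxx *v u) + 2 * (u \<bullet> (Sxy *v v)) + v \<bullet> (Syy *v v)"
    and "transpose Syy = Syy" for u v
    using joint unfolding psd_block_matrix_iff by auto
  moreover have "0 \<le> v \<bullet> (Syy *v v)" for v
    \<comment> \<open>Taking \<open>u = 0\<close> restricts the joint form to the measurement
      block.\<close>
    using quad [of 0 v] by simp
  ultimately have "psd Syy"
    by (simp add: psd_def)
  then have "pd (Rsensor + Syy + R)"
    by (intro pd_add_psd pd_if_positive_diagonal sensor assms)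
  then show ?thesis
    by (simp add: add.commute)
qed

lemma psd_posterior_cov:
  assumes "psd R"
  shows "psd (posterior_cov Sxx Sxy Syy Rsensor Mp R)"
proof -
  let ?W = "Syy + Rsensor + R"
  have "psd (Rsensor + R)"
    by (intro psd_add psd_if_pd pd_if_positive_diagonal sensor assms)
  then have noise: "transpose (Rsensor + R) = Rsensor + R" "0 \<le> v \<bullet> ((Rsensor + R) *v v)" for v
    by (auto simp add: psd_def)
  have prior: "transpose Sxx = Sxx" "transpose Syy = Syy"
    "0 \<le> u \<bullet> (Sxx *v u) + 2 * (u \<bullet> (Sxy *v v)) + v \<bullet> (Syy *v v)" for u v
    using joint unfolding psd_block_matrix_iff by auto
  \<comment> \<open>Noise enters only the measurement block, so the joint form grows by the
    nonnegative form of \<open>Rsensor + R\<close> at \<open>v\<close>.\<close>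
  have "psd (block_matrix Sxx Sxy (transpose Sxy) ?W)"
    unfolding psd_block_matrix_iff
  proof (intro conjI allI)
    show "transpose ?W = ?W"
      by (simp only: add.assoc transpose_add [of Syy] prior noise)
    show "0 \<le> u \<bullet> (Sxx *v u) + 2 * (u \<bullet> (Sxy *v v)) + v \<bullet> (?W *v v)" for u v
      using add_nonneg_nonneg [OF prior(3) [of u v] noise(2) [of v]]
      by (simp add: matrix_vector_mult_add_rdistrib inner_add_right)
  qed (fact prior)
  then have "psd (Sxx - Sxy ** matrix_inv ?W ** transpose Sxy)"
    using psd_block_matrix_schur [OF pd_innovation_cov [OF assms] prior(1)] by blast
  then have "psd (Mp ** (Sxx - Sxy ** matrix_inv ?W ** transpose Sxy) ** transpose Mp)"
    by (rule psd_congruence)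
  then show ?thesis
    by (simp add: posterior_cov_def matrix_mul_assoc matrix_diff_ldistrib matrix_diff_rdistrib)
qed

text \<open>\<open>Q\<close> occurs only in the upper left block, so forming the Schur complement
  merely subtracts it from \<open>posterior_cov\<close>.\<close>

lemma feasible_iff:
  "feasible Sxx Sxy Syy Rsensor Mp gp (R, Q) \<longleftrightarrow>
    psd R \<and> psd Q \<and> psd (posterior_cov Sxx Sxy Syy Rsensor Mp R - Q) \<and> gp \<le> trace Q"
proof -
  have "psd (block_matrix (Mp ** Sxx ** transpose Mp - Q) (Mp ** Sxy)
        (transpose Sxy ** transpose Mp) (Syy + Rsensor + R))
      \<longleftrightarrow> psd (posterior_cov Sxx Sxy Syy Rsensor Mp R - Q)" if "psd R" "psd Q"
  proof -
    have "transpose Sxx = Sxx"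
      using joint by (simp add: psd_block_matrix_iff)
    then have "transpose (Mp ** Sxx ** transpose Mp - Q) = Mp ** Sxx ** transpose Mp - Q"
      using \<open>psd Q\<close> by (simp add: transpose_diff matrix_transpose_mul matrix_mul_assoc psd_def)
    from psd_block_matrix_schur [OF pd_innovation_cov [OF \<open>psd R\<close>] this, of "Mp ** Sxy"]
    show ?thesis
      by (simp add: matrix_transpose_mul posterior_cov_def matrix_mul_assoc algebra_simps)
  qed
  then show ?thesis
    by (auto simp add: feasible_def)
qed

text \<open>This eliminates \<open>Q\<close> from the optimization, whose objective depends on
  \<open>R\<close> alone.\<close>

lemma ex_feasible_iff:
  "(\<exists>Q. feasible Sxx Sxy Syy Rsensor Mp gp (R, Q)) \<longleftrightarrow>
    psd R \<and> gp \<le> trace (posterior_cov Sxx Sxy Syy Rsensor Mp R)"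
proof (intro iffI conjI)
  assume "\<exists>Q. feasible Sxx Sxy Syy Rsensor Mp gp (R, Q)"
  then obtain Q where Q: "feasible Sxx Sxy Syy Rsensor Mp gp (R, Q)" ..
  then show "psd R"
    by (simp add: feasible_iff)
  have "0 \<le> trace (posterior_cov Sxx Sxy Syy Rsensor Mp R - Q)"
    using Q by (intro trace_psd_nonneg) (simp add: feasible_iff)
  with Q show "gp \<le> trace (posterior_cov Sxx Sxy Syy Rsensor Mp R)"
    by (simp add: feasible_iff trace_sub)
next
  assume "psd R \<and> gp \<le> trace (posterior_cov Sxx Sxy Syy Rsensor Mp R)"
  \<comment> \<open>For \<open>Q\<close> equal to the posterior covariance, the difference in
    \<open>feasible_iff\<close> is zero.\<close>
  moreover have "psd (0 :: real ^ 'r ^ 'r)"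
    by (simp add: psd_def transpose_def vec_eq_iff)
  ultimately have "feasible Sxx Sxy Syy Rsensor Mp gp (R, posterior_cov Sxx Sxy Syy Rsensor Mp R)"
    by (simp add: feasible_iff psd_posterior_cov)
  then show "\<exists>Q. feasible Sxx Sxy Syy Rsensor Mp gp (R, Q)" ..
qed

end

theorem theorem3:
  fixes Sxx :: "real ^ 'n ^ 'n"
    and Sxy :: "real ^ 'm ^ 'n"
    and Syy :: "real ^ 'm ^ 'm"
    and Rsensor :: "real ^ 'm ^ 'm"
    and Mp :: "real ^ 'n ^ 'r"
    and gp :: real
    and Rdata :: "real ^ 'm ^ 'm"
    and Qp :: "real ^ 'r ^ 'r"
  assumes "psd (block_matrix Sxx Sxy (transpose Sxy) Syy)"
    and "positive_diagonal Rsensor"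
    and "optimal_solution Sxx Sxy Syy Rsensor Mp gp (Rdata, Qp)"
  shows "trace (posterior_cov Sxx Sxy Syy Rsensor Mp Rdata) \<ge> gp
    \<and> is_arg_min trace
        (\<lambda>R. psd R \<and> trace (posterior_cov Sxx Sxy Syy Rsensor Mp R) \<ge> gp) Rdata"
proof -
  note ex = ex_feasible_iff [OF assms(1,2), of Mp gp]
  have opt: "\<not> trace R < trace Rdata" if "feasible Sxx Sxy Syy Rsensor Mp gp (R, Q)" for R Q
    using assms(3) that unfolding optimal_solution_def is_arg_min_def by auto
  have "feasible Sxx Sxy Syy Rsensor Mp gp (Rdata, Qp)"
    using assms(3) unfolding optimal_solution_def is_arg_min_def by blast
  then have "psd Rdata \<and> gp \<le> trace (posterior_cov Sxx Sxy Syy Rsensor Mp Rdata)"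
    using ex by blast
  \<comment> \<open>A competitor \<open>R\<close> is completed by some \<open>Q\<close> to a
    feasible pair with the same objective value.\<close>
  moreover have "\<not> trace R < trace Rdata"
    if "psd R \<and> gp \<le> trace (posterior_cov Sxx Sxy Syy Rsensor Mp R)" for R
    using that ex opt by blast
  ultimately show ?thesis
    by (auto simp add: is_arg_min_def)
qed

end
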